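(* Let $H$ be a separable infinite-dimensional Hilbert space and let $(f_n)_{n=1}^\infty$ be a frame in $H$ with the analysis operator $U$. Let $V\in\mathbb B(H,l^2)$. Then $V$ is the analysis operator of a frame $(g_n)_{n=1}^\infty$ in $H$ dual to $(f_n)_{n=1}^\infty$ if and only if there exists an oblique projection $F\in\mathbb B(l^2)$ onto $\operatorname{Im}U$ such that the adjoint $V^*$ is given by $V^*=(U^*U)^{-1}U^*F$.
   Context: A sequence $(f_n)_{n=1}^\infty$ in $H$ is a frame if there exist constants $A,B>0$ with $A\|x\|^2\le\sum_{n=1}^\infty|\langle x,f_n\rangle|^2\le B\|x\|^2$ for all $x\in H$. Its analysis operator is the bounded operator $U:H\to l^2$, $Ux=(\langle x,f_n\rangle)_{n=1}^\infty$; the operator $U^*U$ is invertible on $H$. A frame $(g_n)_{n=1}^\infty$ in $H$ is a dual frame of $(f_n)_{n=1}^\infty$ if $x=\sum_{n=1}^{\infty}\langle x,f_n\rangle g_n=\sum_{n=1}^{\infty}\langle x,g_n\rangle f_n$ for all $x\in H$. $\mathbb B(H,K)$ denotes the bounded linear operators from $H$ to $K$, and $\mathbb B(l^2)=\mathbb B(l^2,l^2)$. An oblique projection is a projection (idempotent operator) that need not be orthogonal; it is onto $\operatorname{Im}U$ if its range equals $\operatorname{Im}U$, the range of $U$. *)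

theory Defs
  imports "HOL-Analysis.Analysis"
begin

text \<open>
  Scalar fields. The two axioms on the conjugation determine it, and they force every
  element to be a root of a real quadratic polynomial, so that the instances of this class are
  exactly the real and the complex numbers (up to isomorphism). Statements over a
  type of this class therefore cover real and complex Hilbert spaces at once.
\<close>

class rc_field = real_normed_field + banach +
  fixes kconj :: "'a \<Rightarrow> 'a"
  assumes kconj_add: "kconj (a + b) = kconj a + kconj b"
    and mult_kconj_scaleR: "a * kconj a = (norm a)\<^sup>2 *\<^sub>R 1"

instantiation real :: rc_field
begin
definition kconj_real :: "real \<Rightarrow> real" where "kconj_real a = a"
instance by standard (simp_all add: kconj_real_def power2_eq_square)
end

instantiation complex :: rc_field
begin
definition kconj_complex :: "complex \<Rightarrow> complex" where "kconj_complex = cnj"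
instance by standard (simp_all add: kconj_complex_def complex_norm_square scaleR_conv_of_real del: of_real_power)
end

lemma mult_kconj: "a * kconj a = of_real ((norm a)\<^sup>2)" for a :: "'a::rc_field"
  by (simp only: mult_kconj_scaleR of_real_def)

lemma kconj_0 [simp]: "kconj (0::'a::rc_field) = 0"
  using kconj_add[of "0::'a" 0] by simp

lemma kconj_eq: "kconj a = of_real ((norm a)\<^sup>2) / a" for a :: "'a::rc_field"
proof (cases "a = 0")
  case False
  then show ?thesis using mult_kconj[of a] by (metis nonzero_mult_div_cancel_left)
qed simp

lemma norm_kconj [simp]: "norm (kconj a) = norm a" for a :: "'a::rc_field"
  by (cases "a = 0") (simp_all add: kconj_eq norm_divide norm_power power2_eq_square norm_mult)

lemma kconj_kconj [simp]: "kconj (kconj a) = a" for a :: "'a::rc_field"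
proof (cases "a = 0")
  case False
  then have "kconj a \<noteq> 0" using norm_kconj[of a] by fastforce
  moreover have "kconj a * kconj (kconj a) = kconj a * a"
    using mult_kconj[of "kconj a"] mult_kconj[of a] by (simp add: mult.commute)
  ultimately show ?thesis by simp
qed simp

lemma kconj_mult: "kconj (a * b) = kconj a * kconj b" for a :: "'a::rc_field"
  by (simp add: kconj_eq norm_mult power_mult_distrib)

lemma kconj_root: "a * a - (a + kconj a) * a + of_real ((norm a)\<^sup>2) = 0" for a :: "'a::rc_field"
  using mult_kconj[of a] by (simp add: algebra_simps)

lemma add_kconj_real: "a + kconj a \<in> \<real>" for a :: "'a::rc_field"
proof -
  define b where "b = a + kconj a"
  have "kconj b = b" by (simp add: b_def kconj_add add.commute)
  then have "b * b = of_real (norm b) * of_real (norm b)"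
    using mult_kconj[of b] by (simp add: power2_eq_square)
  then have "b = of_real (norm b) \<or> b = - of_real (norm b)"
    by (simp add: square_eq_iff)
  then have "b \<in> \<real>" by (metis Reals_minus Reals_of_real)
  then show ?thesis by (simp add: b_def)
qed


text \<open>
  A Hilbert space is a complete normed space whose norm comes from a scalar product \<open>ip\<close>,
  linear in the first argument. Norm, topology and the real multiples are those of the type.
\<close>

locale hilbert_space = vector_space scl
  for scl :: "'k::rc_field \<Rightarrow> 'h::banach \<Rightarrow> 'h" +
  fixes ip :: "'h \<Rightarrow> 'h \<Rightarrow> 'k"
  assumes scl_of_real: "scl (of_real r) x = r *\<^sub>R x"
    and ip_add_left: "ip (x + y) z = ip x z + ip y z"
    and ip_scl_left: "ip (scl c x) y = c * ip x y"
    and ip_commute: "ip x y = kconj (ip y x)"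
    and ip_self: "ip x x = of_real ((norm x)\<^sup>2)"

lemma hilbert_space_real_inner:
  "hilbert_space (scaleR :: real \<Rightarrow> 'h \<Rightarrow> 'h::{real_inner,banach}) inner"
  by unfold_locales
    (simp_all add: algebra_simps inner_add_left kconj_real_def inner_commute dot_square_norm)

definition infinite_dimensional :: "('k::field \<Rightarrow> 'h::ab_group_add \<Rightarrow> 'h) \<Rightarrow> bool" where
  "infinite_dimensional scl \<longleftrightarrow> \<not> (\<exists>B. finite B \<and> module.span scl B = UNIV)"

definition bounded_operator ::
  "('k::field \<Rightarrow> 'h::real_normed_vector \<Rightarrow> 'h) \<Rightarrow> ('k \<Rightarrow> 'l::real_normed_vector \<Rightarrow> 'l)
    \<Rightarrow> ('h \<Rightarrow> 'l) \<Rightarrow> bool" where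
  "bounded_operator sclH sclL T \<longleftrightarrow>
     Vector_Spaces.linear sclH sclL T \<and> (\<exists>C. \<forall>x. norm (T x) \<le> C * norm x)"

text \<open>
  The adjoint of \<open>T\<close>, given the scalar products of its domain and codomain. For a bounded
  operator on a Hilbert space it exists and is unique by the Riesz representation theorem.
\<close>

definition adjoint_op ::
  "('h \<Rightarrow> 'h \<Rightarrow> 'k) \<Rightarrow> ('l \<Rightarrow> 'l \<Rightarrow> 'k) \<Rightarrow> ('h \<Rightarrow> 'l) \<Rightarrow> 'l \<Rightarrow> 'h" where
  "adjoint_op ipH ipL T = (THE S. \<forall>x y. ipL (T x) y = ipH x (S y))"


text \<open>The Hilbert space \<open>l\<^sup>2\<close>, with sequences indexed from 0.\<close>

typedef (overloaded) 'k ell2 = "{x :: nat \<Rightarrow> 'k::rc_field. summable (\<lambda>n. (norm (x n))\<^sup>2)}"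
  by (rule exI[of _ "\<lambda>_. 0"]) simp

lemma ell2_eqI: "(\<And>n. Rep_ell2 x n = Rep_ell2 y n) \<Longrightarrow> x = y"
  by (simp add: Rep_ell2_inject[symmetric] fun_eq_iff)

lemma ell2_summable: "summable (\<lambda>n. (norm (Rep_ell2 x n))\<^sup>2)"
  using Rep_ell2[of x] by simp

lemma square_summable_add:
  fixes x y :: "nat \<Rightarrow> 'k::real_normed_vector"
  assumes x: "summable (\<lambda>n. (norm (x n))\<^sup>2)" and y: "summable (\<lambda>n. (norm (y n))\<^sup>2)"
  shows "summable (\<lambda>n. (norm (x n + y n))\<^sup>2)"
proof (rule summable_comparison_test')
  show "summable (\<lambda>n. 2 * (norm (x n))\<^sup>2 + 2 * (norm (y n))\<^sup>2)"
    by (intro summable_add summable_mult x y)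
  fix n
  have "(norm (x n + y n))\<^sup>2 \<le> (norm (x n) + norm (y n))\<^sup>2"
    by (intro power_mono norm_triangle_ineq) simp
  also have "\<dots> \<le> 2 * (norm (x n))\<^sup>2 + 2 * (norm (y n))\<^sup>2"
    using zero_le_power2[of "norm (x n) - norm (y n)"]
    by (simp add: power2_eq_square algebra_simps)
  finally show "norm ((norm (x n + y n))\<^sup>2) \<le> 2 * (norm (x n))\<^sup>2 + 2 * (norm (y n))\<^sup>2" by simp
qed

lemma square_summable_mult:
  fixes x :: "nat \<Rightarrow> 'k::real_normed_field"
  assumes "summable (\<lambda>n. (norm (x n))\<^sup>2)"
  shows "summable (\<lambda>n. (norm (c * x n))\<^sup>2)"
  using summable_mult[OF assms, of "(norm c)\<^sup>2"] by (simp add: norm_mult power_mult_distrib)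

definition ell2_scale :: "'k::rc_field \<Rightarrow> 'k ell2 \<Rightarrow> 'k ell2" where
  "ell2_scale c x = Abs_ell2 (\<lambda>n. c * Rep_ell2 x n)"

definition ell2_inner :: "'k::rc_field ell2 \<Rightarrow> 'k ell2 \<Rightarrow> 'k" where
  "ell2_inner x y = (\<Sum>n. Rep_ell2 x n * kconj (Rep_ell2 y n))"

lemma Rep_ell2_scale [simp]: "Rep_ell2 (ell2_scale c x) n = c * Rep_ell2 x n"
  by (simp add: ell2_scale_def Abs_ell2_inverse square_summable_mult ell2_summable)

instantiation ell2 :: (rc_field) real_normed_vector
begin

definition "0 = (Abs_ell2 (\<lambda>_. 0) :: 'a ell2)"
definition "x + y = Abs_ell2 (\<lambda>n. Rep_ell2 x n + Rep_ell2 y n)" for x y :: "'a ell2"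
definition "- x = ell2_scale (-1) x" for x :: "'a ell2"
definition "x - y = x + - y" for x y :: "'a ell2"
definition "r *\<^sub>R x = ell2_scale (of_real r) x" for x :: "'a ell2"
definition "norm x = sqrt (\<Sum>n. (norm (Rep_ell2 x n))\<^sup>2)" for x :: "'a ell2"
definition "dist x y = norm (x - y)" for x y :: "'a ell2"
definition "sgn x = inverse (norm x) *\<^sub>R x" for x :: "'a ell2"
definition "uniformity = (INF e\<in>{0<..}. principal {(x, y :: 'a ell2). dist x y < e})"
definition "open U \<longleftrightarrow> (\<forall>x\<in>U. eventually (\<lambda>(x', y). x' = x \<longrightarrow> y \<in> U) uniformity)"
  for U :: "'a ell2 set"

lemma Rep_ell2_0: "Rep_ell2 (0::'a ell2) n = 0"
  by (simp add: zero_ell2_def Abs_ell2_inverse)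

lemma Rep_ell2_add: "Rep_ell2 (x + y :: 'a ell2) n = Rep_ell2 x n + Rep_ell2 y n"
  by (simp add: plus_ell2_def Abs_ell2_inverse square_summable_add ell2_summable)

lemma Rep_ell2_minus: "Rep_ell2 (- x :: 'a ell2) n = - Rep_ell2 x n"
  by (simp add: uminus_ell2_def)

lemma Rep_ell2_diff: "Rep_ell2 (x - y :: 'a ell2) n = Rep_ell2 x n - Rep_ell2 y n"
  by (simp add: minus_ell2_def Rep_ell2_add Rep_ell2_minus)

lemma Rep_ell2_scaleR: "Rep_ell2 (r *\<^sub>R x :: 'a ell2) n = r *\<^sub>R Rep_ell2 x n"
  unfolding scaleR_ell2_def Rep_ell2_scale by (simp add: scaleR_conv_of_real)

lemmas Rep_ell2_simps = Rep_ell2_0 Rep_ell2_add Rep_ell2_minus Rep_ell2_diff Rep_ell2_scaleR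

lemma L2_set_le_norm_ell2: "L2_set (\<lambda>n. norm (Rep_ell2 (x::'a ell2) n)) {..<N} \<le> norm x"
  unfolding L2_set_def norm_ell2_def
  by (intro real_sqrt_le_mono sum_le_suminf ell2_summable) auto

lemma norm_ell2_leI:
  assumes "\<And>N. L2_set (\<lambda>n. norm (Rep_ell2 (x::'a ell2) n)) {..<N} \<le> C"
  shows "norm x \<le> C"
proof -
  have C: "0 \<le> C" using assms[of 0] by simp
  have "(\<Sum>n. (norm (Rep_ell2 x n))\<^sup>2) \<le> C\<^sup>2"
  proof (rule suminf_le_const[OF ell2_summable])
    fix N
    have "sqrt (\<Sum>n<N. (norm (Rep_ell2 x n))\<^sup>2) \<le> C" using assms[of N] by (simp add: L2_set_def)
    then show "(\<Sum>n<N. (norm (Rep_ell2 x n))\<^sup>2) \<le> C\<^sup>2" by (rule sqrt_le_D)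
  qed
  then show ?thesis unfolding norm_ell2_def using C by (simp add: real_le_lsqrt)
qed

instance
proof
  fix x y z :: "'a ell2" and r s :: real
  show "x + y + z = x + (y + z)" "x + y = y + x" "0 + x = x" "- x + x = 0" "x - y = x + - y"
    by (simp_all add: ell2_eqI Rep_ell2_simps)
  show "r *\<^sub>R (x + y) = r *\<^sub>R x + r *\<^sub>R y" "(r + s) *\<^sub>R x = r *\<^sub>R x + s *\<^sub>R x"
    "r *\<^sub>R s *\<^sub>R x = (r * s) *\<^sub>R x" "1 *\<^sub>R x = x"
    by (simp_all add: ell2_eqI Rep_ell2_simps algebra_simps)
  show "dist x y = norm (x - y)" by (simp add: dist_ell2_def)
  show "sgn x = inverse (norm x) *\<^sub>R x" by (simp add: sgn_ell2_def)
  show "uniformity = (INF e\<in>{0<..}. principal {(x, y :: 'a ell2). dist x y < e})"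
    by (simp add: uniformity_ell2_def)
  show "open U \<longleftrightarrow> (\<forall>x\<in>U. eventually (\<lambda>(x', y). x' = x \<longrightarrow> y \<in> U) uniformity)"
    for U :: "'a ell2 set"
    by (simp add: open_ell2_def)
  show "norm x = 0 \<longleftrightarrow> x = 0"
  proof
    assume "norm x = 0"
    then have "\<forall>n. (norm (Rep_ell2 x n))\<^sup>2 = 0"
      using suminf_eq_zero_iff[OF ell2_summable[of x]] by (simp add: norm_ell2_def)
    then show "x = 0" by (intro ell2_eqI) (simp add: Rep_ell2_0)
  qed (simp add: norm_ell2_def Rep_ell2_0)
  show "norm (x + y) \<le> norm x + norm y"
  proof (rule norm_ell2_leI)
    fix N
    have "L2_set (\<lambda>n. norm (Rep_ell2 (x + y) n)) {..<N}
        \<le> L2_set (\<lambda>n. norm (Rep_ell2 x n) + norm (Rep_ell2 y n)) {..<N}"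
      by (intro L2_set_mono) (auto simp: Rep_ell2_add norm_triangle_ineq)
    also have "\<dots> \<le> L2_set (\<lambda>n. norm (Rep_ell2 x n)) {..<N} + L2_set (\<lambda>n. norm (Rep_ell2 y n)) {..<N}"
      by (rule L2_set_triangle_ineq)
    also have "\<dots> \<le> norm x + norm y" by (intro add_mono L2_set_le_norm_ell2)
    finally show "L2_set (\<lambda>n. norm (Rep_ell2 (x + y) n)) {..<N} \<le> norm x + norm y" .
  qed
  show "norm (r *\<^sub>R x) = \<bar>r\<bar> * norm x"
    by (simp add: norm_ell2_def Rep_ell2_scaleR power_mult_distrib suminf_mult[OF ell2_summable]
        real_sqrt_mult)
qed

end

lemma norm_Rep_ell2_le: "norm (Rep_ell2 x n) \<le> norm x"
proof -
  have "norm (Rep_ell2 x n) \<le> L2_set (\<lambda>n. norm (Rep_ell2 x n)) {..<Suc n}"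
    by (rule member_le_L2_set) auto
  also have "\<dots> \<le> norm x" by (rule L2_set_le_norm_ell2)
  finally show ?thesis .
qed

instance ell2 :: (rc_field) banach
proof
  fix X :: "nat \<Rightarrow> 'a ell2"
  assume X: "Cauchy X"
  have "Cauchy (\<lambda>i. Rep_ell2 (X i) n)" for n
  proof (rule CauchyI)
    fix e :: real assume "0 < e"
    then obtain M where M: "\<forall>i\<ge>M. \<forall>j\<ge>M. norm (X i - X j) < e" using CauchyD[OF X] by blast
    have "norm (Rep_ell2 (X i) n - Rep_ell2 (X j) n) < e" if "i \<ge> M" "j \<ge> M" for i j
      using norm_Rep_ell2_le[of "X i - X j" n] M that by (force simp: Rep_ell2_diff)
    then show "\<exists>M. \<forall>i\<ge>M. \<forall>j\<ge>M. norm (Rep_ell2 (X i) n - Rep_ell2 (X j) n) < e" by blast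
  qed
  then have "\<forall>n. \<exists>l. (\<lambda>i. Rep_ell2 (X i) n) \<longlonglongrightarrow> l"
    using Cauchy_convergent by (auto simp: convergent_def)
  then obtain a where a: "\<And>n. (\<lambda>i. Rep_ell2 (X i) n) \<longlonglongrightarrow> a n" by metis
  have fin: "L2_set (\<lambda>n. norm (Rep_ell2 (X i) n - a n)) {..<N} \<le> e"
    if M: "\<forall>i\<ge>M. \<forall>j\<ge>M. norm (X i - X j) < e" and i: "i \<ge> M" for M i e N
  proof (rule LIMSEQ_le_const2)
    show "(\<lambda>j. L2_set (\<lambda>n. norm (Rep_ell2 (X i) n - Rep_ell2 (X j) n)) {..<N})
        \<longlonglongrightarrow> L2_set (\<lambda>n. norm (Rep_ell2 (X i) n - a n)) {..<N}"
      unfolding L2_set_def by (intro tendsto_intros a)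
    have "L2_set (\<lambda>n. norm (Rep_ell2 (X i) n - Rep_ell2 (X j) n)) {..<N} \<le> e" if "j \<ge> M" for j
      using L2_set_le_norm_ell2[of "X i - X j" N] M i that
      by (fastforce simp: Rep_ell2_diff)
    then show "\<exists>M. \<forall>j\<ge>M. L2_set (\<lambda>n. norm (Rep_ell2 (X i) n - Rep_ell2 (X j) n)) {..<N} \<le> e"
      by blast
  qed
  obtain M1 where M1: "\<forall>i\<ge>M1. \<forall>j\<ge>M1. norm (X i - X j) < 1"
    using CauchyD[OF X, of 1] by auto
  have "summable (\<lambda>n. (norm (Rep_ell2 (X M1) n - a n))\<^sup>2)"
  proof (rule bounded_imp_summable)
    fix N
    have "sqrt (\<Sum>n<Suc N. (norm (Rep_ell2 (X M1) n - a n))\<^sup>2) \<le> 1"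
      using fin[OF M1, of M1 "Suc N"] by (simp add: L2_set_def)
    then show "(\<Sum>n\<le>N. (norm (Rep_ell2 (X M1) n - a n))\<^sup>2) \<le> 1"
      by (simp add: lessThan_Suc_atMost)
  qed simp
  then have "summable (\<lambda>n. (norm (a n - Rep_ell2 (X M1) n))\<^sup>2)" by (simp add: norm_minus_commute)
  from square_summable_add[OF this ell2_summable[of "X M1"]]
  have a_in: "summable (\<lambda>n. (norm (a n))\<^sup>2)" by simp
  define L where "L = Abs_ell2 a"
  have L: "Rep_ell2 L = a" by (simp add: L_def Abs_ell2_inverse a_in)
  have "X \<longlonglongrightarrow> L"
  proof (rule LIMSEQ_I)
    fix e :: real assume "0 < e"
    then obtain M where M: "\<forall>i\<ge>M. \<forall>j\<ge>M. norm (X i - X j) < e / 2"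
      using CauchyD[OF X, of "e / 2"] by auto
    have "norm (X i - L) \<le> e / 2" if "i \<ge> M" for i
      using fin[OF M that] by (intro norm_ell2_leI) (simp only: Rep_ell2_diff L)
    then show "\<exists>M. \<forall>i\<ge>M. norm (X i - L) < e" using \<open>0 < e\<close> by fastforce
  qed
  then show "convergent X" by (rule convergentI)
qed

lemma ell2_inner_summable: "summable (\<lambda>n. Rep_ell2 x n * kconj (Rep_ell2 y n))"
proof (rule summable_comparison_test')
  show "summable (\<lambda>n. (norm (Rep_ell2 x n))\<^sup>2 + (norm (Rep_ell2 y n))\<^sup>2)"
    by (intro summable_add ell2_summable)
  fix n
  have "norm (Rep_ell2 x n) * norm (Rep_ell2 y n) \<le> (norm (Rep_ell2 x n))\<^sup>2 + (norm (Rep_ell2 y n))\<^sup>2"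
    using sum_squares_bound[of "norm (Rep_ell2 x n)" "norm (Rep_ell2 y n)"]
      mult_nonneg_nonneg[OF norm_ge_zero[of "Rep_ell2 x n"] norm_ge_zero[of "Rep_ell2 y n"]]
    by linarith
  then show "norm (Rep_ell2 x n * kconj (Rep_ell2 y n))
      \<le> (norm (Rep_ell2 x n))\<^sup>2 + (norm (Rep_ell2 y n))\<^sup>2"
    by (simp add: norm_mult)
qed

lemma bounded_linear_kconj: "bounded_linear (kconj :: 'k::rc_field \<Rightarrow> 'k)"
proof (rule bounded_linear_intro[where K = 1])
  show "kconj (r *\<^sub>R a) = r *\<^sub>R kconj a" for r and a :: 'k
    by (simp add: scaleR_conv_of_real kconj_mult kconj_eq[of "of_real r"] power2_eq_square)
qed (simp_all add: kconj_add)

lemma hilbert_space_ell2: "hilbert_space ell2_scale (ell2_inner :: 'k::rc_field ell2 \<Rightarrow> _)"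
proof unfold_locales
  fix x y z :: "'k ell2" and a b :: 'k and r :: real
  show "ell2_scale a (x + y) = ell2_scale a x + ell2_scale a y"
    "ell2_scale (a + b) x = ell2_scale a x + ell2_scale b x"
    "ell2_scale a (ell2_scale b x) = ell2_scale (a * b) x" "ell2_scale 1 x = x"
    by (simp_all add: ell2_eqI Rep_ell2_simps algebra_simps)
  show "ell2_scale (of_real r) x = r *\<^sub>R x" by (simp add: scaleR_ell2_def)
  show "ell2_inner (x + y) z = ell2_inner x z + ell2_inner y z"
    unfolding ell2_inner_def
    by (simp add: Rep_ell2_add distrib_right suminf_add ell2_inner_summable)
  show "ell2_inner (ell2_scale a x) y = a * ell2_inner x y"
    unfolding ell2_inner_def
    by (simp add: mult.assoc suminf_mult ell2_inner_summable)
  show "ell2_inner x y = kconj (ell2_inner y x)"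
    unfolding ell2_inner_def
    by (simp add: bounded_linear.suminf[OF bounded_linear_kconj] ell2_inner_summable
        kconj_mult mult.commute)
  have "0 \<le> (\<Sum>n. (norm (Rep_ell2 x n))\<^sup>2)" by (intro suminf_nonneg ell2_summable) simp
  then show "ell2_inner x x = of_real ((norm x)\<^sup>2)"
    unfolding ell2_inner_def norm_ell2_def
    by (simp add: mult_kconj suminf_of_real[OF ell2_summable] del: of_real_power)
qed


definition is_frame :: "('h \<Rightarrow> 'h \<Rightarrow> 'k::real_normed_vector) \<Rightarrow> (nat \<Rightarrow> 'h::real_normed_vector) \<Rightarrow> bool"
  where
  "is_frame ip f \<longleftrightarrow> (\<exists>A>0. \<exists>B>0. \<forall>x.
     summable (\<lambda>n. (norm (ip x (f n)))\<^sup>2) \<and>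
     A * (norm x)\<^sup>2 \<le> (\<Sum>n. (norm (ip x (f n)))\<^sup>2) \<and>
     (\<Sum>n. (norm (ip x (f n)))\<^sup>2) \<le> B * (norm x)\<^sup>2)"

text \<open>Only meaningful when the coefficient sequences are square summable, as for a frame.\<close>

definition analysis_op :: "('h \<Rightarrow> 'h \<Rightarrow> 'k::rc_field) \<Rightarrow> (nat \<Rightarrow> 'h) \<Rightarrow> 'h \<Rightarrow> 'k ell2" where
  "analysis_op ip f x = Abs_ell2 (\<lambda>n. ip x (f n))"

lemma Rep_analysis_op:
  "is_frame ip f \<Longrightarrow> Rep_ell2 (analysis_op ip f x) n = ip x (f n)"
  unfolding is_frame_def analysis_op_def by (subst Abs_ell2_inverse) auto

definition dual_frame ::
  "('k \<Rightarrow> 'h \<Rightarrow> 'h) \<Rightarrow> ('h \<Rightarrow> 'h \<Rightarrow> 'k::rc_field) \<Rightarrow> (nat \<Rightarrow> 'h::real_normed_vector) \<Rightarrow> (nat \<Rightarrow> 'h) \<Rightarrow> bool"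
  where
  "dual_frame scl ip f g \<longleftrightarrow> is_frame ip g \<and>
     (\<forall>x. (\<lambda>n. scl (ip x (f n)) (g n)) sums x \<and> (\<lambda>n. scl (ip x (g n)) (f n)) sums x)"

definition oblique_projection_onto :: "'k::rc_field ell2 set \<Rightarrow> ('k ell2 \<Rightarrow> 'k ell2) \<Rightarrow> bool" where
  "oblique_projection_onto M F \<longleftrightarrow>
     bounded_operator ell2_scale ell2_scale F \<and> F \<circ> F = F \<and> range F = M"

end

theory Submission
  imports Defs
begin

text \<open>
  Both sides of the equivalence say that \<open>V\<^sup>*\<close> is a left inverse of \<open>U\<close>.

  For the left-hand side, \<open>V\<^sup>* U x = \<Sum>n. \<langle>x, f n\<rangle> V\<^sup>* e\<^sub>n\<close> for the unit vectors \<open>e\<^sub>n\<close> of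
  \<open>l\<^sup>2\<close>, and the only sequence \<open>g\<close> with analysis operator \<open>V\<close> is \<open>g n = V\<^sup>* e\<^sub>n\<close>; so the first
  reconstruction formula is \<open>V\<^sup>* U = 1\<close>. Taking adjoints gives \<open>U\<^sup>* V = 1\<close>, which is the second
  one, and which also bounds \<open>V\<close> from below, so that \<open>g\<close> is a frame
  (\<open>dual_frame_iff_left_inverse\<close>).

  For the right-hand side, if \<open>V\<^sup>* U = 1\<close> then \<open>F = U V\<^sup>*\<close> is idempotent with the range of \<open>U\<close>, and
  \<open>(U\<^sup>* U)\<^sup>-\<^sup>1 U\<^sup>* F = V\<^sup>*\<close>. Conversely a projection \<open>F\<close> onto the range of \<open>U\<close> fixes that range, so
  \<open>(U\<^sup>* U)\<^sup>-\<^sup>1 U\<^sup>* F U = (U\<^sup>* U)\<^sup>-\<^sup>1 U\<^sup>* U = 1\<close>.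

  The analytic input is that adjoints exist and that \<open>U\<^sup>* U\<close> is bijective. Both come from one
  Riesz theorem, \<open>coercive_form_representation\<close>, for Hermitian forms whose quadratic form is
  comparable with the square of the norm: the form \<open>\<langle>x, y\<rangle>\<close> yields the adjoint, and the form
  \<open>\<langle>U x, U y\<rangle> = \<langle>x, U\<^sup>* U y\<rangle>\<close>, coercive by the lower frame bound, yields the surjectivity of \<open>U\<^sup>* U\<close>.
\<close>

section \<open>Positive Hermitian forms\<close>

lemma kconj_of_real: "kconj (of_real r) = (of_real r :: 'k::rc_field)"
  by (simp add: kconj_eq power2_eq_square)

text \<open>
  The diagonal is recorded by a real function \<open>q\<close> because the scalars of an \<open>rc_field\<close> carry
  neither an order nor a real part; inequalities are derived from scalar identities through the
  injectivity of \<open>of_real\<close>.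
\<close>

locale positive_form = vector_space scl
  for scl :: "'k::rc_field \<Rightarrow> 'h::ab_group_add \<Rightarrow> 'h" +
  fixes a :: "'h \<Rightarrow> 'h \<Rightarrow> 'k" and q :: "'h \<Rightarrow> real"
  assumes form_add_left: "a (x + y) z = a x z + a y z"
    and form_scl_left: "a (scl c x) y = c * a x y"
    and form_commute: "a x y = kconj (a y x)"
    and form_self: "a x x = of_real (q x)"
    and form_nonneg: "0 \<le> q x"
begin

lemma form_add_right: "a x (y + z) = a x y + a x z"
  by (metis form_commute form_add_left kconj_add)

lemma form_scl_right: "a x (scl c y) = kconj c * a x y"
  by (metis form_commute form_scl_left kconj_mult)

lemma form_minus_left: "a (- x) y = - a x y"
  using form_scl_left[of "-1" x y] by simp

lemma form_diff_left: "a (x - y) z = a x z - a y z"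
  using form_add_left[of x "- y" z] form_minus_left[of y z] by simp

lemma form_diff_right: "a x (y - z) = a x y - a x z"
  using form_add_right[of x "y - z" z] by simp

lemma form_parallelogram: "q (x + y) + q (x - y) = 2 * q x + 2 * q y"
proof -
  have "a (x + y) (x + y) + a (x - y) (x - y) = 2 * a x x + 2 * a y y"
    by (simp add: form_add_left form_add_right form_diff_left form_diff_right)
  then have "(of_real (q (x + y) + q (x - y)) :: 'k) = of_real (2 * q x + 2 * q y)"
    by (simp add: form_self)
  then show ?thesis by (simp only: of_real_eq_iff)
qed

lemma form_scl_self: "q (scl c x) = (norm c)\<^sup>2 * q x"
proof -
  have "(of_real (q (scl c x)) :: 'k) = (c * kconj c) * of_real (q x)"
    by (simp add: form_self[symmetric] form_scl_left form_scl_right)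
  then show ?thesis by (simp only: mult_kconj of_real_mult[symmetric] of_real_eq_iff)
qed

text \<open>
  Pythagoras for the component of \<open>x\<close> along \<open>y\<close>. This one identity gives the Cauchy-Schwarz
  inequality, since the left-hand side is nonnegative, and the orthogonality of minimisers, since
  the right-hand side is less than \<open>q x\<close> unless \<open>a x y = 0\<close>.
\<close>

lemma form_remove_component:
  assumes "q y \<noteq> 0"
  shows "q (x - scl (a x y / of_real (q y)) y) = q x - (norm (a x y))\<^sup>2 / q y"
proof -
  define c where "c = a x y / of_real (q y)"
  have "kconj c * of_real (q y) = a y x"
    using assms arg_cong[where f = kconj, of "c * of_real (q y)" "a x y"]
    by (metis c_def form_commute form_self kconj_mult nonzero_divide_eq_eq of_real_eq_0_iff)
  moreover have "c * of_real (q y) = a x y" using assms by (simp add: c_def)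
  moreover have "a (x - scl c y) (x - scl c y)
      = a x x - kconj c * a x y - c * a y x + c * (kconj c * of_real (q y))"
    by (simp add: form_diff_left form_diff_right form_scl_left form_scl_right form_self[of y] algebra_simps)
  ultimately have "a (x - scl c y) (x - scl c y) = a x x - kconj c * a x y"
    by simp
  moreover have "kconj c * a x y = of_real ((norm (a x y))\<^sup>2 / q y)"
  proof -
    have "kconj c = a y x / of_real (q y)"
      using \<open>kconj c * of_real (q y) = a y x\<close> assms by (simp add: nonzero_eq_divide_eq)
    then have "kconj c * a x y = (a x y * kconj (a x y)) / of_real (q y)"
      by (metis form_commute mult.commute times_divide_eq_right)
    then show ?thesis by (simp only: mult_kconj of_real_divide[symmetric])
  qed
  ultimately have "(of_real (q (x - scl c y)) :: 'k) = of_real (q x - (norm (a x y))\<^sup>2 / q y)"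
    by (simp add: form_self del: of_real_power)
  then show ?thesis unfolding c_def by (simp only: of_real_eq_iff)
qed

lemma form_Cauchy_Schwarz:
  assumes "q y \<noteq> 0"
  shows "(norm (a x y))\<^sup>2 \<le> q x * q y"
proof -
  have "(norm (a x y))\<^sup>2 / q y \<le> q x"
    using form_remove_component[OF assms, of x] form_nonneg by (smt (verit))
  then show ?thesis using assms form_nonneg[of y] by (simp add: divide_le_eq)
qed

lemma form_minimal_orthogonal:
  assumes min: "\<And>c. q w \<le> q (w - scl c v)" and v: "q v \<noteq> 0"
  shows "a w v = 0"
proof -
  have "(norm (a w v))\<^sup>2 / q v \<le> 0"
    using min[of "a w v / of_real (q v)"] form_remove_component[OF v, of w] by simp
  then show ?thesis using v form_nonneg[of v] by (simp add: divide_le_0_iff)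
qed

end

section \<open>Riesz representation for coercive forms\<close>

context hilbert_space
begin

sublocale positive_form scl ip "\<lambda>x. (norm x)\<^sup>2"
  by unfold_locales (simp_all add: ip_add_left ip_scl_left ip_self flip: ip_commute)

text \<open>
  Although conjugate linear in its second argument, a form is bilinear over the reals, so that the
  continuity results for \<open>bounded_bilinear\<close> apply to it.
\<close>

lemma bounded_bilinear_form:
  assumes "positive_form scl a q" and pos: "\<And>x. x \<noteq> 0 \<Longrightarrow> 0 < q x"
    and bound: "\<And>x. q x \<le> B * (norm x)\<^sup>2"
  shows "bounded_bilinear a"
proof -
  interpret a: positive_form scl a q by fact
  have "norm (a x y) \<le> norm x * norm y * \<bar>B\<bar>" for x y
  proof (cases "y = 0")
    case True
    then show ?thesis using a.form_diff_right[of x 0 0] by simp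
  next
    case False
    have B: "q z \<le> \<bar>B\<bar> * (norm z)\<^sup>2" for z
      using bound[of z] by (meson abs_ge_self mult_right_mono order_trans zero_le_power2)
    have "(norm (a x y))\<^sup>2 \<le> q x * q y"
      using a.form_Cauchy_Schwarz pos[OF False] by simp
    also have "\<dots> \<le> (\<bar>B\<bar> * (norm x)\<^sup>2) * (\<bar>B\<bar> * (norm y)\<^sup>2)"
      by (intro mult_mono B a.form_nonneg) simp
    also have "\<dots> = (norm x * norm y * \<bar>B\<bar>)\<^sup>2"
      by (simp add: power_mult_distrib power2_eq_square mult_ac)
    finally show ?thesis by (rule power2_le_imp_le) simp
  qed
  then have bd: "\<exists>K. \<forall>x y. norm (a x y) \<le> norm x * norm y * K" by blast
  have l: "a (r *\<^sub>R x) y = r *\<^sub>R a x y" for r x y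
    using a.form_scl_left[of "of_real r" x y] by (simp add: scl_of_real scaleR_conv_of_real)
  have r: "a x (r *\<^sub>R y) = r *\<^sub>R a x y" for r x y
    using a.form_scl_right[of x "of_real r" y]
    by (simp add: scl_of_real scaleR_conv_of_real kconj_of_real)
  show ?thesis
    by (intro bounded_bilinear.intro a.form_add_left a.form_add_right l r bd)
qed

lemma bounded_bilinear_ip: "bounded_bilinear ip"
  by (rule bounded_bilinear_form[OF positive_form_axioms, where B = 1]) simp_all

lemma norm_ip_le: "norm (ip x y) \<le> norm x * norm y"
proof (cases "y = 0")
  case True
  then show ?thesis using form_diff_right[of x 0 0] by simp
next
  case False
  then have "(norm (ip x y))\<^sup>2 \<le> (norm x * norm y)\<^sup>2"
    using form_Cauchy_Schwarz[of y x] by (simp add: power_mult_distrib)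
  then show ?thesis by (rule power2_le_imp_le) simp
qed

lemma ip_right_eqI:
  assumes "\<And>x. ip x y = ip x z"
  shows "y = z"
proof -
  have "ip (y - z) (y - z) = 0" using assms[of "y - z"] by (simp add: form_diff_right)
  then show ?thesis by (simp add: ip_self)
qed

text \<open>
  In the parallelogram law for two points of the hyperplane \<open>\<phi> = 1\<close>, their midpoint lies in the
  hyperplane too. Hence a sequence there along which \<open>q\<close> tends to its infimum is Cauchy for \<open>q\<close>,
  and by coercivity for the norm.
\<close>

lemma coercive_form_minimiser:
  fixes \<phi> :: "'h \<Rightarrow> 'k"
  assumes form: "positive_form scl a q"
    and A: "0 < A" "\<And>x. A * (norm x)\<^sup>2 \<le> q x" and B: "\<And>x. q x \<le> B * (norm x)\<^sup>2"
    and add: "\<And>x y. \<phi> (x + y) = \<phi> x + \<phi> y" and scl: "\<And>c x. \<phi> (scl c x) = c * \<phi> x"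
    and bound: "\<And>x. norm (\<phi> x) \<le> C * norm x" and u: "\<phi> u = 1"
  obtains w where "\<phi> w = 1" "\<And>x. \<phi> x = 1 \<Longrightarrow> q w \<le> q x"
proof -
  interpret a: positive_form scl a q by fact
  have scaleR: "\<phi> (r *\<^sub>R x) = r *\<^sub>R \<phi> x" for r x
    using scl[of "of_real r" x] by (simp add: scl_of_real scaleR_conv_of_real)
  interpret \<phi>: bounded_linear \<phi>
    by (rule bounded_linear_intro[where K = C]) (use add scaleR bound in \<open>simp_all add: mult.commute\<close>)
  define d where "d = Inf (q ` {x. \<phi> x = 1})"
  have bdd: "bdd_below (q ` {x. \<phi> x = 1})" using a.form_nonneg by (intro bdd_belowI[of _ 0]) auto
  have d_le: "d \<le> q x" if "\<phi> x = 1" for x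
    unfolding d_def using that bdd by (auto intro: cInf_lower)
  have "\<exists>x. \<phi> x = 1 \<and> q x < d + e" if "0 < e" for e
    using cInf_lessD[of "q ` {x. \<phi> x = 1}" "d + e"] u that by (auto simp: d_def)
  then have "\<exists>x. \<phi> x = 1 \<and> q x < d + inverse (real (Suc n))" for n by simp
  then obtain X where X: "\<And>n. \<phi> (X n) = 1" "\<And>n. q (X n) < d + inverse (real (Suc n))"
    by metis
  \<comment> \<open>The midpoint of \<open>X m\<close> and \<open>X n\<close> has \<open>\<phi> = 1\<close>, so \<open>q (X m + X n) \<ge> 4 d\<close>.\<close>
  have close: "A * (norm (X m - X n))\<^sup>2 \<le> 2 * inverse (real (Suc m)) + 2 * inverse (real (Suc n))"
    for m n
  proof -
    have "\<phi> ((1/2) *\<^sub>R (X m + X n)) = 1"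
      by (simp only: scaleR add X) (simp add: scaleR_conv_of_real)
    then have "d \<le> q (scl (of_real (1/2)) (X m + X n))" using d_le by (metis scl_of_real)
    then have "4 * d \<le> q (X m + X n)" by (simp add: a.form_scl_self norm_divide power2_eq_square)
    then have "q (X m - X n) \<le> 2 * inverse (real (Suc m)) + 2 * inverse (real (Suc n))"
      using a.form_parallelogram[of "X m" "X n"] X(2)[of m] X(2)[of n] by linarith
    then show ?thesis using A(2)[of "X m - X n"] by linarith
  qed
  have "Cauchy X"
  proof (rule CauchyI)
    fix e :: real assume e: "0 < e"
    obtain M where M: "inverse (real (Suc M)) < A * e\<^sup>2 / 4"
      using reals_Archimedean[of "A * e\<^sup>2 / 4"] A(1) e by auto
    have "norm (X m - X n) < e" if "M \<le> m" "M \<le> n" for m n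
    proof -
      have "inverse (real (Suc m)) \<le> inverse (real (Suc M))"
        "inverse (real (Suc n)) \<le> inverse (real (Suc M))"
        using that by (simp_all add: divide_simps)
      then have "A * (norm (X m - X n))\<^sup>2 < A * e\<^sup>2"
        using close[of m n] M by linarith
      then have "(norm (X m - X n))\<^sup>2 < e\<^sup>2" using A(1) by simp
      then show ?thesis using e by (simp add: power_less_imp_less_base)
    qed
    then show "\<exists>M. \<forall>m\<ge>M. \<forall>n\<ge>M. norm (X m - X n) < e" by blast
  qed
  then obtain w where w: "X \<longlonglongrightarrow> w" using Cauchy_convergent by (auto simp: convergent_def)
  have "(\<lambda>n. \<phi> (X n)) \<longlonglongrightarrow> \<phi> w" by (rule \<phi>.tendsto[OF w])
  then have "\<phi> w = 1" using X(1) by (simp add: LIMSEQ_const_iff)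
  moreover have "q w \<le> d"
  proof -
    have pos: "0 < q x" if "x \<noteq> 0" for x
    proof -
      have "0 < A * (norm x)\<^sup>2" using A(1) that by simp
      then show ?thesis using A(2)[of x] by linarith
    qed
    have "(\<lambda>n. a (X n) (X n)) \<longlonglongrightarrow> a w w"
      by (rule bounded_bilinear.tendsto[OF bounded_bilinear_form[OF form pos B] w w])
    then have "(\<lambda>n. q (X n)) \<longlonglongrightarrow> q w"
      by (simp add: a.form_self tendsto_of_real_iff)
    moreover have "(\<lambda>n. d + inverse (real (Suc n))) \<longlonglongrightarrow> d"
      by (rule LIMSEQ_inverse_real_of_nat_add)
    ultimately show ?thesis using X(2) by (intro LIMSEQ_le) (auto intro: less_imp_le)
  qed
  ultimately show thesis using d_le that by (meson order_trans)
qed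

text \<open>
  The minimiser \<open>w\<close> of \<open>q\<close> on the hyperplane \<open>\<phi> = 1\<close> is orthogonal to the kernel of \<open>\<phi>\<close>. As
  \<open>x - scl (\<phi> x) w\<close> lies in this kernel, \<open>a x w = \<phi> x * of_real (q w)\<close>, and \<open>w\<close> has only to be divided by \<open>q w\<close>.
\<close>

lemma coercive_form_representation:
  fixes \<phi> :: "'h \<Rightarrow> 'k"
  assumes form: "positive_form scl a q"
    and A: "0 < A" "\<And>x. A * (norm x)\<^sup>2 \<le> q x" and B: "\<And>x. q x \<le> B * (norm x)\<^sup>2"
    and add: "\<And>x y. \<phi> (x + y) = \<phi> x + \<phi> y" and scl: "\<And>c x. \<phi> (scl c x) = c * \<phi> x"
    and bound: "\<And>x. norm (\<phi> x) \<le> C * norm x"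
  shows "\<exists>w. \<forall>x. \<phi> x = a x w"
proof (cases "\<forall>x. \<phi> x = 0")
  interpret a: positive_form scl a q by fact
  case True
  then have "\<forall>x. \<phi> x = a x 0" using a.form_diff_right[of _ 0 0] by simp
  then show ?thesis by blast
next
  interpret a: positive_form scl a q by fact
  case False
  then obtain x0 where x0: "\<phi> x0 \<noteq> 0" by blast
  define u where "u = scl (inverse (\<phi> x0)) x0"
  have u: "\<phi> u = 1" using x0 by (simp add: u_def scl)
  obtain w where w: "\<phi> w = 1" and min: "\<And>x. \<phi> x = 1 \<Longrightarrow> q w \<le> q x"
    using coercive_form_minimiser[OF form A B add scl bound u] by blast
  have diff: "\<phi> (x - y) = \<phi> x - \<phi> y" for x y
    using add[of "x - y" y] by simp
  have pos: "q x \<noteq> 0" if "x \<noteq> 0" for x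
    using A(1) A(2)[of x] that by (smt (verit) mult_pos_pos zero_less_norm_iff zero_less_power)
  have orth: "a v w = 0" if "\<phi> v = 0" for v
  proof (cases "v = 0")
    case True
    then show ?thesis using a.form_diff_left[of 0 0 w] by simp
  next
    case False
    have "a w v = 0"
      by (rule a.form_minimal_orthogonal[OF min pos[OF False]]) (simp add: diff scl w that)
    then show ?thesis by (metis a.form_commute kconj_0)
  qed
  have "w \<noteq> 0" using w diff[of 0 0] by auto
  then have qw: "q w \<noteq> 0" by (rule pos)
  have "\<phi> x = a x (scl (inverse (of_real (q w))) w)" for x
  proof -
    have "a (x - scl (\<phi> x) w) w = 0" by (rule orth) (simp add: diff scl w)
    then have *: "a x w = \<phi> x * of_real (q w)"
      by (simp add: a.form_diff_left a.form_scl_left a.form_self)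
    have "kconj (inverse (of_real (q w))) = (inverse (of_real (q w)) :: 'k)"
      by (simp only: of_real_inverse[symmetric] kconj_of_real)
    then show ?thesis using qw by (simp add: a.form_scl_right *)
  qed
  then show ?thesis by blast
qed

end

section \<open>Adjoints\<close>

locale hilbert_operator =
  dom: hilbert_space sclH ipH + cod: hilbert_space sclL ipL
  for sclH :: "'k::rc_field \<Rightarrow> 'h::banach \<Rightarrow> 'h" and ipH :: "'h \<Rightarrow> 'h \<Rightarrow> 'k"
    and sclL :: "'k \<Rightarrow> 'l::banach \<Rightarrow> 'l" and ipL :: "'l \<Rightarrow> 'l \<Rightarrow> 'k" +
  fixes T :: "'h \<Rightarrow> 'l"
  assumes bounded_operator: "bounded_operator sclH sclL T"
begin

lemma op_add: "T (x + y) = T x + T y" and op_scl: "T (sclH c x) = sclL c (T x)"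
proof -
  interpret Vector_Spaces.linear sclH sclL T
    using bounded_operator by (simp add: bounded_operator_def)
  show "T (x + y) = T x + T y" "T (sclH c x) = sclL c (T x)" by (rule add scale)+
qed

lemma op_bound: obtains C where "0 < C" "\<And>x. norm (T x) \<le> C * norm x"
proof -
  obtain C where C: "\<And>x. norm (T x) \<le> C * norm x"
    using bounded_operator by (auto simp: bounded_operator_def)
  have "norm (T x) \<le> (\<bar>C\<bar> + 1) * norm x" for x
    using C[of x] mult_right_mono[of C "\<bar>C\<bar> + 1" "norm x"] by (smt (verit) norm_ge_zero)
  then show thesis using that[of "\<bar>C\<bar> + 1"] by simp
qed

lemma bounded_linear_op: "bounded_linear T"
proof -
  obtain C where C: "\<And>x. norm (T x) \<le> C * norm x" using op_bound by blast
  show ?thesis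
  proof (rule bounded_linear_intro[where K = C])
    show "T (r *\<^sub>R x) = r *\<^sub>R T x" for r x
      using op_scl[of "of_real r" x] by (simp add: dom.scl_of_real cod.scl_of_real)
  qed (simp_all add: op_add C mult.commute)
qed

lemma adjoint_op_eqI:
  assumes "\<And>x y. ipL (T x) y = ipH x (S y)"
  shows "adjoint_op ipH ipL T = S"
  unfolding adjoint_op_def
proof (rule the_equality)
  fix S' assume "\<forall>x y. ipL (T x) y = ipH x (S' y)"
  then show "S' = S" using assms by (intro ext dom.ip_right_eqI) metis
qed (simp add: assms)

text \<open>
  For fixed \<open>y\<close> the functional \<open>x \<mapsto> \<langle>T x, y\<rangle>\<close> is bounded, so the representation theorem for the
  scalar product itself provides the value of the adjoint at \<open>y\<close>.
\<close>

lemma adjoint: "ipL (T x) y = ipH x (adjoint_op ipH ipL T y)"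
proof -
  obtain C where C: "0 < C" "\<And>x. norm (T x) \<le> C * norm x" using op_bound by blast
  have "\<exists>w. \<forall>x. ipL (T x) y = ipH x w" for y
  proof (rule dom.coercive_form_representation[OF dom.positive_form_axioms, where A = 1 and B = 1
        and C = "C * norm y"])
    show "norm (ipL (T x) y) \<le> C * norm y * norm x" for x
      using cod.norm_ip_le[of "T x" y] mult_right_mono[OF C(2)[of x] norm_ge_zero[of y]]
      by (simp add: mult_ac)
  qed (simp_all add: op_add op_scl cod.ip_add_left cod.ip_scl_left)
  then obtain S where S: "\<And>x y. ipL (T x) y = ipH x (S y)" by metis
  then show ?thesis using adjoint_op_eqI[of S] by simp
qed

lemma adjoint': "ipL y (T x) = ipH (adjoint_op ipH ipL T y) x"
  by (metis adjoint dom.ip_commute cod.ip_commute)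

lemma hilbert_operator_adjoint:
  "hilbert_operator sclL ipL sclH ipH (adjoint_op ipH ipL T)"
proof unfold_locales
  let ?S = "adjoint_op ipH ipL T"
  obtain C where C: "0 < C" "\<And>x. norm (T x) \<le> C * norm x" using op_bound by blast
  have add: "?S (x + y) = ?S x + ?S y" for x y
    by (rule dom.ip_right_eqI) (simp add: dom.form_add_right cod.form_add_right flip: adjoint)
  have scl: "?S (sclL c x) = sclH c (?S x)" for c x
    by (rule dom.ip_right_eqI) (simp add: dom.form_scl_right cod.form_scl_right flip: adjoint)
  have "norm (?S y) \<le> C * norm y" for y
  proof (cases "?S y = 0")
    case False
    have "(norm (?S y))\<^sup>2 = norm (ipL (T (?S y)) y)"
      by (simp add: adjoint dom.ip_self norm_power)
    also have "\<dots> \<le> norm (T (?S y)) * norm y" by (rule cod.norm_ip_le)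
    also have "\<dots> \<le> C * norm (?S y) * norm y" by (intro mult_right_mono C) simp
    finally show ?thesis using False by (simp add: power2_eq_square mult_ac)
  qed (use C(1) in simp)
  then show "bounded_operator sclL sclH ?S"
    unfolding bounded_operator_def Vector_Spaces.linear_iff
    using add scl dom.vector_space_axioms cod.vector_space_axioms by blast
qed

text \<open>
  Since \<open>\<langle>T x, T y\<rangle> = \<langle>x, T\<^sup>* T y\<rangle>\<close>, a preimage of \<open>z\<close> under \<open>T\<^sup>* T\<close> is a vector that represents the
  functional \<open>x \<mapsto> \<langle>x, z\<rangle>\<close> by the form on the left, which is coercive when \<open>T\<close> is bounded below.
\<close>

lemma bij_adjoint_comp:
  assumes A: "0 < A" "\<And>x. A * (norm x)\<^sup>2 \<le> (norm (T x))\<^sup>2"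
  shows "bij (adjoint_op ipH ipL T \<circ> T)"
proof (rule bijI)
  let ?S = "adjoint_op ipH ipL T"
  interpret T: bounded_linear T by (rule bounded_linear_op)
  interpret S: hilbert_operator sclL ipL sclH ipH ?S by (rule hilbert_operator_adjoint)
  interpret S: bounded_linear ?S by (rule S.bounded_linear_op)
  obtain C where C: "0 < C" "\<And>x. norm (T x) \<le> C * norm x" using op_bound by blast
  show "inj (?S \<circ> T)"
  proof (rule injI)
    fix x y assume "(?S \<circ> T) x = (?S \<circ> T) y"
    then have "?S (T (x - y)) = 0" by (simp add: T.diff S.diff)
    then have "ipL (T (x - y)) (T (x - y)) = 0"
      using dom.form_diff_right[of "x - y" 0 0] by (simp add: adjoint)
    then have "A * (norm (x - y))\<^sup>2 \<le> 0" using A(2)[of "x - y"] by (simp add: cod.ip_self)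
    then show "x = y" using A(1) by (simp add: mult_le_0_iff)
  qed
  have form: "positive_form sclH (\<lambda>x y. ipL (T x) (T y)) (\<lambda>x. (norm (T x))\<^sup>2)"
    by unfold_locales
      (simp_all add: op_add op_scl cod.ip_add_left cod.ip_scl_left cod.ip_self flip: cod.ip_commute)
  show "surj (?S \<circ> T)"
    unfolding surj_def
  proof
    fix z
    have "\<exists>w. \<forall>x. ipH x z = ipL (T x) (T w)"
    proof (rule dom.coercive_form_representation[OF form A, where B = "C\<^sup>2" and C = "norm z"])
      show "(norm (T x))\<^sup>2 \<le> C\<^sup>2 * (norm x)\<^sup>2" for x
        using power_mono[OF C(2)[of x], of 2] by (simp add: power_mult_distrib)
      show "norm (ipH x z) \<le> norm z * norm x" for x
        using dom.norm_ip_le[of x z] by (simp add: mult.commute)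
    qed (simp_all add: dom.ip_add_left dom.ip_scl_left)
    then obtain w where "\<And>x. ipH x z = ipH x (?S (T w))" by (auto simp: adjoint)
    then have "z = (?S \<circ> T) w" by (simp add: dom.ip_right_eqI)
    then show "\<exists>w. z = (?S \<circ> T) w" by blast
  qed
qed

end

section \<open>Unit vectors of \<open>l\<^sup>2\<close>\<close>

definition ell2_unit :: "nat \<Rightarrow> 'k::rc_field ell2" where
  "ell2_unit n = Abs_ell2 (\<lambda>m. if m = n then 1 else 0)"

lemma Rep_ell2_unit: "Rep_ell2 (ell2_unit n :: 'k::rc_field ell2) m = (if m = n then 1 else 0)"
proof -
  have "summable (\<lambda>m. (norm (if m = n then 1 else 0 :: 'k))\<^sup>2)"
    by (rule summable_finite[of "{n}"]) auto
  then show ?thesis by (simp add: ell2_unit_def Abs_ell2_inverse)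
qed

lemma ell2_inner_unit: "ell2_inner x (ell2_unit n) = Rep_ell2 x n"
proof -
  have "kconj (1::'a) = 1" using kconj_of_real[of 1] by simp
  then have "(\<lambda>m. Rep_ell2 x m * kconj (Rep_ell2 (ell2_unit n) m))
      = (\<lambda>m. if m = n then Rep_ell2 x m else 0)"
    by (auto simp: Rep_ell2_unit)
  moreover have "(\<lambda>m. if m = n then Rep_ell2 x m else 0) sums Rep_ell2 x n"
    by (rule sums_single)
  ultimately show ?thesis unfolding ell2_inner_def by (simp add: sums_iff)
qed

text \<open>
  The remainder after \<open>N\<close> terms is \<open>x\<close> with its first \<open>N\<close> entries deleted, whose squared norm is a
  tail of the convergent series of the \<open>\<bar>x\<^sub>n\<bar>\<^sup>2\<close>.
\<close>

lemma ell2_unit_expansion: "(\<lambda>n. ell2_scale (Rep_ell2 x n) (ell2_unit n)) sums x"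
proof -
  let ?s = "\<lambda>N. \<Sum>n<N. ell2_scale (Rep_ell2 x n) (ell2_unit n)"
  have Rep: "Rep_ell2 (?s N) m = (if m < N then Rep_ell2 x m else 0)" for N m
    by (induction N) (auto simp: Rep_ell2_simps Rep_ell2_unit less_Suc_eq)
  have tail: "(norm (?s N - x))\<^sup>2 = (\<Sum>m. (norm (Rep_ell2 x m))\<^sup>2) - (\<Sum>m<N. (norm (Rep_ell2 x m))\<^sup>2)"
    for N
  proof -
    let ?r = "\<lambda>m. (norm (Rep_ell2 (?s N - x) m))\<^sup>2"
    have r: "?r m = (if m < N then 0 else (norm (Rep_ell2 x m))\<^sup>2)" for m
      by (simp add: Rep_ell2_diff Rep)
    have "(norm (?s N - x))\<^sup>2 = suminf ?r"
      unfolding norm_ell2_def by (simp add: suminf_nonneg[OF ell2_summable])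
    also have "\<dots> = (\<Sum>m. ?r (m + N)) + (\<Sum>m<N. ?r m)"
      by (rule suminf_split_initial_segment[OF ell2_summable])
    also have "\<dots> = (\<Sum>m. (norm (Rep_ell2 x (m + N)))\<^sup>2)" by (simp add: r)
    also have "\<dots> = (\<Sum>m. (norm (Rep_ell2 x m))\<^sup>2) - (\<Sum>m<N. (norm (Rep_ell2 x m))\<^sup>2)"
      by (rule suminf_minus_initial_segment[OF ell2_summable])
    finally show ?thesis .
  qed
  have "(\<lambda>N. (\<Sum>m. (norm (Rep_ell2 x m))\<^sup>2) - (\<Sum>m<N. (norm (Rep_ell2 x m))\<^sup>2)) \<longlonglongrightarrow> 0"
    using tendsto_diff[OF tendsto_const[of "\<Sum>m. (norm (Rep_ell2 x m))\<^sup>2"]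
        summable_LIMSEQ[OF ell2_summable[of x]]] by simp
  then have "(\<lambda>N. sqrt ((norm (?s N - x))\<^sup>2)) \<longlonglongrightarrow> sqrt 0"
    unfolding tail by (rule tendsto_real_sqrt)
  then have "(\<lambda>N. norm (?s N - x)) \<longlonglongrightarrow> 0" by simp
  then have "(\<lambda>N. ?s N - x) \<longlonglongrightarrow> 0" by (rule tendsto_norm_zero_cancel)
  then show ?thesis unfolding sums_def by (rule LIM_zero_cancel)
qed

section \<open>Analysis operators and dual frames\<close>

lemma norm_analysis_op:
  assumes "is_frame ip f"
  shows "(norm (analysis_op ip f x))\<^sup>2 = (\<Sum>n. (norm (ip x (f n)))\<^sup>2)"
  unfolding norm_ell2_def using suminf_nonneg[OF ell2_summable[of "analysis_op ip f x"]]
  by (simp add: Rep_analysis_op[OF assms])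

lemma hilbert_operator_analysis_op:
  assumes "hilbert_space scl ip" and f: "is_frame ip f"
  shows "hilbert_operator scl ip ell2_scale ell2_inner (analysis_op ip f)"
proof -
  interpret hilbert_space scl ip by fact
  interpret l2: hilbert_space ell2_scale ell2_inner by (rule hilbert_space_ell2)
  let ?U = "analysis_op ip f"
  obtain B where B: "0 < B" "\<And>x. (\<Sum>n. (norm (ip x (f n)))\<^sup>2) \<le> B * (norm x)\<^sup>2"
    using f unfolding is_frame_def by blast
  have "norm (?U x) \<le> sqrt B * norm x" for x
  proof (rule power2_le_imp_le)
    show "(norm (?U x))\<^sup>2 \<le> (sqrt B * norm x)\<^sup>2"
      using B by (simp add: norm_analysis_op[OF f] power_mult_distrib)
  qed (use B(1) in simp)
  moreover have "?U (x + y) = ?U x + ?U y" for x y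
    by (rule ell2_eqI) (simp add: Rep_ell2_add Rep_analysis_op[OF f] ip_add_left)
  moreover have "?U (scl c x) = ell2_scale c (?U x)" for c x
    by (rule ell2_eqI) (simp add: Rep_analysis_op[OF f] ip_scl_left)
  ultimately have "bounded_operator scl ell2_scale ?U"
    unfolding bounded_operator_def Vector_Spaces.linear_iff
    using vector_space_axioms l2.vector_space_axioms by blast
  then show ?thesis by unfold_locales
qed

context hilbert_operator
begin

lemma bounded_operator_comp_adjoint:
  assumes "hilbert_operator sclH ipH sclL ipL W"
  shows "bounded_operator sclL sclL (W \<circ> adjoint_op ipH ipL T)"
proof -
  interpret S: hilbert_operator sclL ipL sclH ipH "adjoint_op ipH ipL T"
    by (rule hilbert_operator_adjoint)
  interpret W: hilbert_operator sclH ipH sclL ipL W by fact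
  have "\<exists>C. \<forall>x. norm ((W \<circ> adjoint_op ipH ipL T) x) \<le> norm x * C"
    using bounded_linear.bounded[OF bounded_linear_compose[OF W.bounded_linear_op S.bounded_linear_op]]
    by simp
  then show ?thesis
    unfolding bounded_operator_def Vector_Spaces.linear_iff
    using cod.vector_space_axioms
    by (simp add: S.op_add S.op_scl W.op_add W.op_scl mult.commute)
qed

end

text \<open>
  For an analysis operator this is the synthesis formula \<open>U\<^sup>* y = \<Sum>n. y\<^sub>n f n\<close>, because there
  \<open>U\<^sup>* e\<^sub>n = f n\<close>.
\<close>

lemma adjoint_unit_expansion:
  fixes V :: "'h::banach \<Rightarrow> 'k::rc_field ell2"
  assumes "hilbert_operator scl ip ell2_scale ell2_inner V"
  shows "(\<lambda>n. scl (Rep_ell2 y n) (adjoint_op ip ell2_inner V (ell2_unit n)))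
    sums adjoint_op ip ell2_inner V y"
proof -
  interpret V: hilbert_operator scl ip ell2_scale ell2_inner V by fact
  interpret S: hilbert_operator ell2_scale ell2_inner scl ip "adjoint_op ip ell2_inner V"
    by (rule V.hilbert_operator_adjoint)
  show ?thesis
    using bounded_linear.sums[OF S.bounded_linear_op ell2_unit_expansion[of y]]
    by (simp add: S.op_scl)
qed

text \<open>
  Every bounded operator into \<open>l\<^sup>2\<close> takes scalar products with a fixed sequence of vectors, the
  images of the unit vectors under its adjoint.
\<close>

lemma ip_adjoint_unit:
  fixes V :: "'h::banach \<Rightarrow> 'k::rc_field ell2"
  assumes "hilbert_operator scl ip ell2_scale ell2_inner V"
  shows "ip x (adjoint_op ip ell2_inner V (ell2_unit n)) = Rep_ell2 (V x) n"
  using hilbert_operator.adjoint[OF assms, of x "ell2_unit n"] by (simp add: ell2_inner_unit)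

text \<open>
  Given duality, \<open>\<langle>U x, V y\<rangle> = \<Sum>n. \<langle>x, f n\<rangle> \<langle>g n, y\<rangle> = \<langle>x, y\<rangle>\<close> by continuity of the scalar product.
  Conversely \<open>V\<^sup>* U = 1\<close> implies \<open>U\<^sup>* V = 1\<close>; expanding \<open>U x\<close> and \<open>V x\<close> in unit vectors and applying
  \<open>V\<^sup>*\<close> and \<open>U\<^sup>*\<close> gives the two reconstruction formulas for \<open>g n = V\<^sup>* e\<^sub>n\<close>.
\<close>

lemma dual_frame_iff_left_inverse:
  fixes V :: "'h::banach \<Rightarrow> 'k::rc_field ell2"
  assumes H: "hilbert_space scl ip" and f: "is_frame ip f"
    and V: "hilbert_operator scl ip ell2_scale ell2_inner V"
  shows "(\<exists>g. dual_frame scl ip f g \<and> V = analysis_op ip g) \<longleftrightarrow>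
    (\<forall>x. adjoint_op ip ell2_inner V (analysis_op ip f x) = x)" (is "?dual \<longleftrightarrow> ?left")
proof -
  let ?U = "analysis_op ip f"
  let ?Us = "adjoint_op ip ell2_inner ?U" and ?Vs = "adjoint_op ip ell2_inner V"
  interpret hilbert_space scl ip by fact
  interpret V: hilbert_operator scl ip ell2_scale ell2_inner V by fact
  note U = hilbert_operator_analysis_op[OF H f]
  interpret U: hilbert_operator scl ip ell2_scale ell2_inner ?U by (rule U)
  interpret ip: bounded_bilinear ip by (rule bounded_bilinear_ip)
  show ?thesis
  proof
    assume ?dual
    then obtain g where g: "dual_frame scl ip f g" "V = analysis_op ip g" by blast
    have Vg: "Rep_ell2 (V y) n = ip y (g n)" for y n
      using g by (simp add: dual_frame_def Rep_analysis_op)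
    have inner: "ell2_inner (?U x) (V y) = ip x y" for x y
    proof -
      have "(\<lambda>n. scl (ip x (f n)) (g n)) sums x" using g(1) by (simp add: dual_frame_def)
      then have "(\<lambda>n. ip (scl (ip x (f n)) (g n)) y) sums ip x y"
        by (rule bounded_linear.sums[OF ip.bounded_linear_left])
      moreover have "ip (scl (ip x (f n)) (g n)) y
          = Rep_ell2 (?U x) n * kconj (Rep_ell2 (V y) n)" for n
        by (simp add: ip_scl_left Rep_analysis_op[OF f] Vg flip: ip_commute)
      ultimately show ?thesis by (simp add: ell2_inner_def sums_iff)
    qed
    show ?left
    proof
      fix x
      have "ip y (?Vs (?U x)) = ip y x" for y
        by (metis V.adjoint inner ip_commute V.cod.ip_commute)
      then show "?Vs (?U x) = x" by (rule ip_right_eqI)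
    qed
  next
    assume left: ?left
    have left': "?Us (V x) = x" for x
    proof (rule ip_right_eqI)
      show "ip y (?Us (V x)) = ip y x" for y
        by (metis U.adjoint V.adjoint' left)
    qed
    define g where "g n = ?Vs (ell2_unit n)" for n
    have Vg: "Rep_ell2 (V x) n = ip x (g n)" for x n
      by (simp add: g_def ip_adjoint_unit[OF V])
    have normV: "(norm (V x))\<^sup>2 = (\<Sum>n. (norm (ip x (g n)))\<^sup>2)" for x
      unfolding norm_ell2_def using suminf_nonneg[OF ell2_summable[of "V x"]] by (simp add: Vg)
    have frame: "is_frame ip g"
    proof -
      obtain C where C: "0 < C" "\<And>x. norm (V x) \<le> C * norm x" using V.op_bound by blast
      interpret Us: hilbert_operator ell2_scale ell2_inner scl ip ?Us
        by (rule U.hilbert_operator_adjoint)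
      obtain D where D: "0 < D" "\<And>y. norm (?Us y) \<le> D * norm y" using Us.op_bound by blast
      have upper: "(norm (V x))\<^sup>2 \<le> C\<^sup>2 * (norm x)\<^sup>2" for x
        using power_mono[OF C(2)[of x], of 2] by (simp add: power_mult_distrib)
      \<comment> \<open>\<open>x = U\<^sup>* V x\<close>, so a bound for \<open>U\<^sup>*\<close> bounds \<open>V\<close> from below.\<close>
      have lower: "inverse (D\<^sup>2) * (norm x)\<^sup>2 \<le> (norm (V x))\<^sup>2" for x
      proof -
        have "norm x \<le> D * norm (V x)" using D(2)[of "V x"] by (simp add: left')
        then have "(norm x)\<^sup>2 \<le> D\<^sup>2 * (norm (V x))\<^sup>2"
          using power_mono[of "norm x" "D * norm (V x)" 2] by (simp add: power_mult_distrib)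
        then show ?thesis using D(1) by (simp add: divide_simps mult.commute)
      qed
      have "summable (\<lambda>n. (norm (ip x (g n)))\<^sup>2)" for x
        using ell2_summable[of "V x"] by (simp add: Vg)
      then show ?thesis
        unfolding is_frame_def using upper lower C(1) D(1)
        by (intro exI[of _ "inverse (D\<^sup>2)"] exI[of _ "C\<^sup>2"] conjI) (simp_all flip: normV)
    qed
    have Us_unit: "?Us (ell2_unit n) = f n" for n
      by (rule ip_right_eqI) (simp add: ip_adjoint_unit[OF U] Rep_analysis_op[OF f])
    have "(\<lambda>n. scl (ip x (f n)) (g n)) sums x" for x
      using adjoint_unit_expansion[OF V, of "?U x"] left
      by (simp add: g_def Rep_analysis_op[OF f])
    moreover have "(\<lambda>n. scl (ip x (g n)) (f n)) sums x" for x
      using adjoint_unit_expansion[OF U, of "V x"] by (simp add: left' Us_unit Vg)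
    ultimately have "dual_frame scl ip f g" using frame by (simp add: dual_frame_def)
    moreover have "V = analysis_op ip g"
      by (intro ext ell2_eqI) (simp add: Vg Rep_analysis_op[OF frame])
    ultimately show ?dual by blast
  qed
qed

theorem corollary2p4:
  fixes scl :: "'k::rc_field \<Rightarrow> 'h::banach \<Rightarrow> 'h"
    and ip :: "'h \<Rightarrow> 'h \<Rightarrow> 'k"
    and f :: "nat \<Rightarrow> 'h"
    and U V :: "'h \<Rightarrow> 'k ell2"
  assumes "hilbert_space scl ip"
    and "separable_space (euclidean :: 'h topology)"
    and "infinite_dimensional scl"
    and "is_frame ip f"
    and "U = analysis_op ip f"
    and "bounded_operator scl ell2_scale V"
  shows "(\<exists>g. dual_frame scl ip f g \<and> V = analysis_op ip g) \<longleftrightarrow>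
    (\<exists>F. oblique_projection_onto (range U) F \<and>
      adjoint_op ip ell2_inner V =
        inv (adjoint_op ip ell2_inner U \<circ> U) \<circ> adjoint_op ip ell2_inner U \<circ> F)"
proof -
  let ?Us = "adjoint_op ip ell2_inner U" and ?Vs = "adjoint_op ip ell2_inner V"
  note f = assms(4)
  have V: "hilbert_operator scl ip ell2_scale ell2_inner V"
    using assms(1,6) hilbert_space_ell2 by (simp add: hilbert_operator_def hilbert_operator_axioms_def)
  interpret V: hilbert_operator scl ip ell2_scale ell2_inner V by (rule V)
  have U: "hilbert_operator scl ip ell2_scale ell2_inner U"
    unfolding assms(5) by (rule hilbert_operator_analysis_op[OF assms(1) f])
  interpret U: hilbert_operator scl ip ell2_scale ell2_inner U by (rule U)
  obtain A where A: "0 < A" "\<And>x. A * (norm x)\<^sup>2 \<le> (norm (U x))\<^sup>2"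
    using f unfolding assms(5) norm_analysis_op[OF f] is_frame_def by blast
  have bij: "bij (?Us \<circ> U)" by (rule U.bij_adjoint_comp[OF A])
  have inv: "inv (?Us \<circ> U) (?Us (U x)) = x" for x
    using inv_f_f[OF bij_is_inj[OF bij], of x] by simp
  have "(\<forall>x. ?Vs (U x) = x) \<longleftrightarrow>
    (\<exists>F. oblique_projection_onto (range U) F \<and> ?Vs = inv (?Us \<circ> U) \<circ> ?Us \<circ> F)"
  proof
    assume left: "\<forall>x. ?Vs (U x) = x"
    have "range (U \<circ> ?Vs) = range U"
    proof
      show "range U \<subseteq> range (U \<circ> ?Vs)"
        by (auto intro!: image_eqI[where x = "U _"] simp: left)
    qed auto
    moreover have "(U \<circ> ?Vs) \<circ> (U \<circ> ?Vs) = U \<circ> ?Vs" by (simp add: fun_eq_iff left)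
    ultimately have "oblique_projection_onto (range U) (U \<circ> ?Vs)"
      using V.bounded_operator_comp_adjoint[OF U] by (simp add: oblique_projection_onto_def)
    moreover have "?Vs = inv (?Us \<circ> U) \<circ> ?Us \<circ> (U \<circ> ?Vs)" by (simp add: fun_eq_iff inv)
    ultimately show "\<exists>F. oblique_projection_onto (range U) F \<and> ?Vs = inv (?Us \<circ> U) \<circ> ?Us \<circ> F"
      by blast
  next
    assume "\<exists>F. oblique_projection_onto (range U) F \<and> ?Vs = inv (?Us \<circ> U) \<circ> ?Us \<circ> F"
    then obtain F where F: "F \<circ> F = F" "range F = range U" and Vs: "?Vs = inv (?Us \<circ> U) \<circ> ?Us \<circ> F"
      by (auto simp: oblique_projection_onto_def)
    have "F (U x) = U x" for x
    proof -
      obtain y where "U x = F y" using F(2) by (metis imageE rangeI)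
      then show ?thesis using F(1) by (metis comp_apply)
    qed
    then show "\<forall>x. ?Vs (U x) = x" by (simp add: Vs inv del: o_assoc)
  qed
  then show ?thesis
    using dual_frame_iff_left_inverse[OF assms(1) f V] assms(5) by simp
qed

end
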